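(* Let $\vec r=\langle r_0,\dots,r_{n-1}\rangle$ be a finite tuple of parameters and let $\varphi\in\mathrm{Fm}(p,\vec r)$. Then $\varphi$ is a normal additive formula in $\mathrm{S5}$ (with respect to $p$) if and only if $\varphi$ is $\mathrm{S5}$-equivalent to a formula of the form $$(\lambda\wedge p)\vee\bigvee_{i<k}\bigl(\mu_i\wedge\Diamond(\nu_i\wedge p)\bigr)\vee\bot,\qquad k\in\omega,\ \lambda,\mu_i,\nu_i\in\mathrm{Fm}(\vec r).$$
   Context: Modal formulas are built from propositional variables using Boolean connectives, $\bot$, $\top$, $\Diamond$ and $\Box$. The variables $p$ and $q$ are distinct non-parameter variables; parameters are variables distinct from $p$ and $q$. $\mathrm{Fm}(p,\vec r)$ is the set of modal formulas containing no variables other than $p,r_0,\dots,r_{n-1}$; $\mathrm{Fm}(\vec r)$ is the set of modal formulas containing no variables other than $r_0,\dots,r_{n-1}$. For a normal modal logic $\Lambda$, formulas $\varphi,\psi$ are $\Lambda$-equivalent if $\Lambda\vdash\varphi\leftrightarrow\psi$. A formula $\varphi(p,\vec r)$ is additive in $\Lambda$ if $\Lambda\vdash\varphi(p\vee q,\vec r)\leftrightarrow\varphi(p,\vec r)\vee\varphi(q,\vec r)$, and normal in $\Lambda$ if $\Lambda\vdash\varphi(\bot,\vec r)\leftrightarrow\bot$; it is a normal additive formula in $\Lambda$ if it is both. $\mathrm{S5}$ is the usual normal modal logic of frames whose relation is an equivalence relation. An empty disjunction is $\bot$. *)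

theory Defs
  imports Main
begin

datatype (vars: 'v) fm =
    Var 'v
  | Bot
  | Top
  | Neg "'v fm"
  | And "'v fm" "'v fm"
  | Or "'v fm" "'v fm"
  | Imp "'v fm" "'v fm"
  | Dia "'v fm"
  | Box "'v fm"

definition Iff :: "'v fm \<Rightarrow> 'v fm \<Rightarrow> 'v fm" where
  "Iff A B = And (Imp A B) (Imp B A)"

text \<open>Iterated disjunction; the empty disjunction is \<open>\<bottom>\<close>.\<close>

fun Disj :: "'v fm list \<Rightarrow> 'v fm" where
  "Disj [] = Bot"
| "Disj [A] = A"
| "Disj (A # B # As) = Or A (Disj (B # As))"

definition Fm :: "'v set \<Rightarrow> 'v fm set" where
  "Fm X = {A. vars A \<subseteq> X}"

primrec subst :: "('v \<Rightarrow> 'v fm) \<Rightarrow> 'v fm \<Rightarrow> 'v fm" where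
  "subst \<sigma> (Var x) = \<sigma> x"
| "subst \<sigma> Bot = Bot"
| "subst \<sigma> Top = Top"
| "subst \<sigma> (Neg A) = Neg (subst \<sigma> A)"
| "subst \<sigma> (And A B) = And (subst \<sigma> A) (subst \<sigma> B)"
| "subst \<sigma> (Or A B) = Or (subst \<sigma> A) (subst \<sigma> B)"
| "subst \<sigma> (Imp A B) = Imp (subst \<sigma> A) (subst \<sigma> B)"
| "subst \<sigma> (Dia A) = Dia (subst \<sigma> A)"
| "subst \<sigma> (Box A) = Box (subst \<sigma> A)"

definition subst1 :: "'v \<Rightarrow> 'v fm \<Rightarrow> 'v fm \<Rightarrow> 'v fm" where
  "subst1 p B A = subst (Var(p := B)) A"

text \<open>A logic is given by its set of theorems.\<close>

definition equivalent_in :: "'v fm set \<Rightarrow> 'v fm \<Rightarrow> 'v fm \<Rightarrow> bool" where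
  "equivalent_in \<Lambda> A B \<longleftrightarrow> Iff A B \<in> \<Lambda>"

definition additive_in :: "'v fm set \<Rightarrow> 'v \<Rightarrow> 'v \<Rightarrow> 'v fm \<Rightarrow> bool" where
  "additive_in \<Lambda> p q A \<longleftrightarrow>
     Iff (subst1 p (Or (Var p) (Var q)) A) (Or A (subst1 p (Var q) A)) \<in> \<Lambda>"

definition normal_in :: "'v fm set \<Rightarrow> 'v \<Rightarrow> 'v fm \<Rightarrow> bool" where
  "normal_in \<Lambda> p A \<longleftrightarrow> Iff (subst1 p Bot A) Bot \<in> \<Lambda>"

definition normal_additive_in :: "'v fm set \<Rightarrow> 'v \<Rightarrow> 'v \<Rightarrow> 'v fm \<Rightarrow> bool" where
  "normal_additive_in \<Lambda> p q A \<longleftrightarrow> normal_in \<Lambda> p A \<and> additive_in \<Lambda> p q A"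

primrec sat :: "'w set \<Rightarrow> ('w \<times> 'w) set \<Rightarrow> ('v \<Rightarrow> 'w set) \<Rightarrow> 'w \<Rightarrow> 'v fm \<Rightarrow> bool" where
  "sat W R V w (Var x) \<longleftrightarrow> w \<in> V x"
| "sat W R V w Bot \<longleftrightarrow> False"
| "sat W R V w Top \<longleftrightarrow> True"
| "sat W R V w (Neg A) \<longleftrightarrow> \<not> sat W R V w A"
| "sat W R V w (And A B) \<longleftrightarrow> sat W R V w A \<and> sat W R V w B"
| "sat W R V w (Or A B) \<longleftrightarrow> sat W R V w A \<or> sat W R V w B"
| "sat W R V w (Imp A B) \<longleftrightarrow> (sat W R V w A \<longrightarrow> sat W R V w B)"
| "sat W R V w (Dia A) \<longleftrightarrow> (\<exists>u\<in>W. (w, u) \<in> R \<and> sat W R V u A)"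
| "sat W R V w (Box A) \<longleftrightarrow> (\<forall>u\<in>W. (w, u) \<in> R \<longrightarrow> sat W R V u A)"

definition valid_on :: "'w set \<Rightarrow> ('w \<times> 'w) set \<Rightarrow> 'v fm \<Rightarrow> bool" where
  "valid_on W R A \<longleftrightarrow> (\<forall>V. \<forall>w\<in>W. sat W R V w A)"

text \<open>
  A definition cannot quantify over the type of worlds, so the frames here have worlds in
  \<^typ>\<open>nat\<close>. This is no restriction: by \<open>S5_valid_on\<close> below, the members of \<open>S5\<close> are valid
  on every equivalence frame over every type.
\<close>

definition S5 :: "'v fm set" where
  "S5 = {A. \<forall>(W :: nat set) R. equiv W R \<longrightarrow> valid_on W R A}"

lemma finite_vars: "finite (vars A)"
  by (induction A) auto

lemma S5_valid_on:
  fixes W :: "'w set" and A :: "'v fm"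
  assumes "A \<in> S5" and R: "equiv W R"
  shows "valid_on W R A"
  unfolding valid_on_def
proof (intro allI ballI)
  fix V :: "'v \<Rightarrow> 'w set" and w
  assume w: "w \<in> W"
  define C where "C = R `` {w}"
  define key where "key v = {x \<in> vars A. v \<in> V x}" for v
  have "finite (key ` C)"
    by (rule finite_subset[of _ "Pow (vars A)"]) (auto simp: key_def finite_vars)
  then obtain g :: "'v set \<Rightarrow> nat" where g: "inj_on g (key ` C)"
    using finite_imp_inj_to_nat_seg by blast
  define h where "h v = g (key v)" for v
  define W' where "W' = h ` C"
  define V' where "V' x = h ` (C \<inter> V x)" for x
  have CW: "C \<subseteq> W" using R by (auto simp: C_def equiv_def)
  have wC: "w \<in> C" using R w by (auto simp: C_def equiv_def refl_on_def)
  have CR: "u \<in> C \<longleftrightarrow> (v, u) \<in> R" if "v \<in> C" for u v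
    using R that unfolding C_def equiv_def sym_def trans_def by blast
  have key_eq: "key v = key u" if "h v = h u" "v \<in> C" "u \<in> C" for u v
    using that g by (auto simp: h_def inj_on_def)
  have "sat W R V v B \<longleftrightarrow> sat W' (W' \<times> W') V' (h v) B"
    if "vars B \<subseteq> vars A" "v \<in> C" for B v
    using that
  proof (induction B arbitrary: v)
    case (Var x)
    have "v \<in> V x" if "u \<in> C" "u \<in> V x" "h v = h u" for u
      using key_eq[OF that(3) Var(2) that(1)] that Var by (auto simp: key_def)
    then show ?case using Var by (auto simp: V'_def)
  next
    case (Dia B)
    then have "(\<exists>u\<in>W. (v, u) \<in> R \<and> sat W R V u B) \<longleftrightarrow> (\<exists>u\<in>C. sat W R V u B)"
      using CR CW by blast
    then show ?case using Dia by (auto simp: W'_def)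
  next
    case (Box B)
    then have "(\<forall>u\<in>W. (v, u) \<in> R \<longrightarrow> sat W R V u B) \<longleftrightarrow> (\<forall>u\<in>C. sat W R V u B)"
      using CR CW by blast
    then show ?case using Box by (auto simp: W'_def)
  qed auto
  moreover have "sat W' (W' \<times> W') V' (h w) A"
  proof -
    have "equiv W' (W' \<times> W')"
      by (auto simp: equiv_def refl_on_def sym_def trans_def)
    moreover have "h w \<in> W'" using wC by (simp add: W'_def)
    ultimately show ?thesis using assms(1) by (auto simp: S5_def valid_on_def)
  qed
  ultimately show "sat W R V w A" using wC by blast
qed

end

theory Submission
  imports Defs
begin

text \<open>
  Over a universal frame, \<open>\<phi>\<close> only sees which subsets of the parameters (types) are realised, and
  for each of them whether it is realised inside and outside the extension of \<open>p\<close>. So every model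
  is bisimilar to one with three copies of each realised type. There, additivity and normality
  reduce the truth of \<open>\<phi>\<close> at \<open>w\<close> to extensions of \<open>p\<close> that are singletons \<open>{u}\<close>. Whether \<open>\<phi>\<close> then
  holds at \<open>w\<close> depends only on the set of realised types, on the types of \<open>w\<close> and \<open>u\<close> and on whether
  \<open>u = w\<close>, and these data are definable by formulas in the parameters. The case \<open>u = w\<close> yields
  \<open>\<lambda>\<close>, the case \<open>u \<noteq> w\<close> yields the disjuncts with \<open>\<mu>\<close> and \<open>\<nu>\<close>.
\<close>

section \<open>Semantics and reduction of S5 to universal frames\<close>

abbreviation usat :: "'w set \<Rightarrow> ('v \<Rightarrow> 'w set) \<Rightarrow> 'w \<Rightarrow> 'v fm \<Rightarrow> bool" where
  "usat W \<equiv> sat W (W \<times> W)"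

lemma sat_Disj: "sat W R V w (Disj As) \<longleftrightarrow> (\<exists>A\<in>set As. sat W R V w A)"
  by (induction As rule: Disj.induct) auto

lemma vars_Disj: "vars (Disj As) = (\<Union>A\<in>set As. vars A)"
  by (induction As rule: Disj.induct) auto

lemma sat_Iff: "sat W R V w (Iff A B) \<longleftrightarrow> (sat W R V w A \<longleftrightarrow> sat W R V w B)"
  by (auto simp: Iff_def)

lemma sat_subst:
  "sat W R V w (subst \<sigma> A) \<longleftrightarrow> sat W R (\<lambda>x. {u. sat W R V u (\<sigma> x)}) w A"
  by (induction A arbitrary: w) auto

lemma sat_subst1:
  "sat W R V w (subst1 p B A) \<longleftrightarrow> sat W R (V(p := {u. sat W R V u B})) w A"
proof -
  have "(\<lambda>x. {u. sat W R V u ((Var(p := B)) x)}) = V(p := {u. sat W R V u B})"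
    by (rule ext) auto
  then show ?thesis by (simp only: subst1_def sat_subst)
qed

text \<open>Evaluation from a point of an equivalence class never leaves that class, and inside it
  the relation is universal.\<close>

lemma sat_generated:
  assumes "equiv W R" "w \<in> W" "u \<in> R `` {w}"
  shows "sat W R V u A \<longleftrightarrow> usat (R `` {w}) V u A"
  using assms(3)
proof (induction A arbitrary: u)
  case (Dia A)
  have "(\<exists>v\<in>W. (u, v) \<in> R \<and> sat W R V v A) \<longleftrightarrow> (\<exists>v\<in>R `` {w}. sat W R V v A)"
    using assms(1) Dia.prems unfolding equiv_def sym_def trans_def by blast
  then show ?case using Dia by auto
next
  case (Box A)
  have "(\<forall>v\<in>W. (u, v) \<in> R \<longrightarrow> sat W R V v A) \<longleftrightarrow> (\<forall>v\<in>R `` {w}. sat W R V v A)"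
    using assms(1) Box.prems unfolding equiv_def sym_def trans_def by blast
  then show ?case using Box by auto
qed auto

lemma equiv_universal: "equiv W (W \<times> W)"
  by (auto simp: equiv_def refl_on_def sym_def trans_def)

text \<open>The type of worlds is arbitrary here, so theorems of S5 can also be evaluated in models
  whose worlds are built from sets of variables.\<close>

lemma S5_usat: "A \<in> S5 \<Longrightarrow> w \<in> W \<Longrightarrow> usat W V w A"
  using S5_valid_on[OF _ equiv_universal, of A W] by (auto simp: valid_on_def)

lemma S5_I:
  assumes "\<And>(W :: nat set) V w. w \<in> W \<Longrightarrow> usat W V w A"
  shows "A \<in> S5"
  unfolding S5_def valid_on_def
proof (intro CollectI allI impI ballI)
  fix W :: "nat set" and R V w
  assume W: "equiv W R" "w \<in> W"
  then have "w \<in> R `` {w}"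
    by (auto simp: equiv_def refl_on_def)
  then show "sat W R V w A"
    using sat_generated[OF W] assms by blast
qed

text \<open>In a universal frame every world sees every world, so the back and forth conditions need
  not be local: totality of \<open>Z\<close> in both directions suffices.\<close>

lemma usat_bisim:
  assumes "\<And>u v x. Z u v \<Longrightarrow> x \<in> vars A \<Longrightarrow> u \<in> V x \<longleftrightarrow> v \<in> V' x"
    and "\<And>u. u \<in> W \<Longrightarrow> \<exists>v\<in>W'. Z u v" and "\<And>v. v \<in> W' \<Longrightarrow> \<exists>u\<in>W. Z u v"
    and "Z w w'" "w \<in> W" "w' \<in> W'"
  shows "usat W V w A \<longleftrightarrow> usat W' V' w' A"
  using assms(1,4-)
proof (induction A arbitrary: w w')
  case (Dia A)
  then have "usat W V u A \<longleftrightarrow> usat W' V' v A" if "Z u v" "u \<in> W" "v \<in> W'" for u v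
    using that by auto
  then have "(\<exists>u\<in>W. usat W V u A) \<longleftrightarrow> (\<exists>v\<in>W'. usat W' V' v A)"
    using assms(2,3) by meson
  then show ?case using Dia.prems by auto
next
  case (Box A)
  then have "usat W V u A \<longleftrightarrow> usat W' V' v A" if "Z u v" "u \<in> W" "v \<in> W'" for u v
    using that by auto
  then have "(\<forall>u\<in>W. usat W V u A) \<longleftrightarrow> (\<forall>v\<in>W'. usat W' V' v A)"
    using assms(2,3) by meson
  then show ?case using Box.prems by auto
next
  case (Var x)
  then show ?case by auto
next
  case (Neg A)
  from Neg.IH[of w w'] Neg.prems show ?case by auto
next
  case (And A B)
  from And.IH(1)[of w w'] And.IH(2)[of w w'] And.prems show ?case by auto
next
  case (Or A B)
  from Or.IH(1)[of w w'] Or.IH(2)[of w w'] Or.prems show ?case by auto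
next
  case (Imp A B)
  from Imp.IH(1)[of w w'] Imp.IH(2)[of w w'] Imp.prems show ?case by auto
qed auto

lemma sat_cong:
  assumes "\<And>x. x \<in> vars A \<Longrightarrow> V x = V' x"
  shows "sat W R V w A \<longleftrightarrow> sat W R V' w A"
  using assms by (induction A arbitrary: w) auto

lemma sat_upd: "x \<notin> vars A \<Longrightarrow> sat W R (V(x := P)) w A \<longleftrightarrow> sat W R V w A"
  by (rule sat_cong) auto

section \<open>Types and their definability\<close>

definition type_of :: "'v set \<Rightarrow> ('v \<Rightarrow> 'w set) \<Rightarrow> 'w \<Rightarrow> 'v set" where
  "type_of X V w = {x \<in> X. w \<in> V x}"

lemma ex_Disj:
  assumes "finite Y" "\<And>y. y \<in> Y \<Longrightarrow> f y \<in> Fm X"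
  shows "\<exists>A\<in>Fm X. \<forall>W R V w. sat W R V w A \<longleftrightarrow> (\<exists>y\<in>Y. sat W R V w (f y))"
proof -
  obtain ys where ys: "set ys = Y" using assms(1) finite_list by blast
  show ?thesis
    by (rule bexI[of _ "Disj (map f ys)"])
      (use assms(2) in \<open>auto simp: sat_Disj Fm_def vars_Disj ys\<close>)
qed

lemma ex_Conj:
  assumes "finite Y" "\<And>y. y \<in> Y \<Longrightarrow> f y \<in> Fm X"
  shows "\<exists>A\<in>Fm X. \<forall>W R V w. sat W R V w A \<longleftrightarrow> (\<forall>y\<in>Y. sat W R V w (f y))"
proof -
  obtain ys where ys: "set ys = Y" using assms(1) finite_list by blast
  show ?thesis
    by (rule bexI[of _ "Neg (Disj (map (\<lambda>y. Neg (f y)) ys))"])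
      (use assms(2) in \<open>auto simp: sat_Disj Fm_def vars_Disj ys\<close>)
qed

lemma type_definable:
  assumes "finite X" "t \<subseteq> X"
  shows "\<exists>A\<in>Fm X. \<forall>(W :: 'w set) R V w. sat W R V w A \<longleftrightarrow> type_of X V w = t"
proof -
  define f where "f x = (if x \<in> t then Var x else Neg (Var x))" for x
  have "(\<forall>x\<in>X. sat W R V w (f x)) \<longleftrightarrow> type_of X V w = t"
    for W :: "'w set" and R V w
    using assms(2) by (auto simp: f_def type_of_def)
  moreover have "\<exists>A\<in>Fm X. \<forall>(W :: 'w set) R V w. sat W R V w A \<longleftrightarrow> (\<forall>x\<in>X. sat W R V w (f x))"
    by (rule ex_Conj[OF assms(1)]) (auto simp: f_def Fm_def)
  ultimately show ?thesis by simp
qed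

text \<open>As \<open>X\<close> is finite, there are finitely many pairs of a set of realised types
  and a current type. Each pair has a describing formula, and the disjunction over the pairs
  satisfying \<open>Q\<close> expresses \<open>Q\<close>.\<close>

lemma types_definable:
  assumes X: "finite X"
  shows "\<exists>A\<in>Fm X. \<forall>(W :: 'w set) V w. w \<in> W \<longrightarrow>
    (usat W V w A \<longleftrightarrow> Q (type_of X V ` W) (type_of X V w))"
proof -
  obtain \<tau> where \<tau>: "\<tau> t \<in> Fm X" "sat W R V w (\<tau> t) \<longleftrightarrow> type_of X V w = t"
    if "t \<subseteq> X" for t and W :: "'w set" and R V w
    using type_definable[OF X] by metis
  have sub: "type_of X V w \<subseteq> X" for V and w :: 'w by (auto simp: type_of_def)
  have "\<exists>A\<in>Fm X. \<forall>(W :: 'w set) V w. w \<in> W \<longrightarrow> (usat W V w A \<longleftrightarrow> type_of X V ` W = S)"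
    if S: "S \<subseteq> Pow X" for S
  proof -
    \<comment> \<open>In a universal frame \<open>Dia (\<tau> t)\<close> says that \<open>t\<close>
      is realised somewhere, so these conjuncts fix the set of realised types.\<close>
    define f where "f t = (if t \<in> S then Dia (\<tau> t) else Neg (Dia (\<tau> t)))" for t
    have "f t \<in> Fm X" if "t \<in> Pow X" for t
      using that \<tau>(1)[of t] by (auto simp: f_def Fm_def)
    then obtain A where A: "A \<in> Fm X"
      "\<And>(W :: 'w set) R V w. sat W R V w A \<longleftrightarrow> (\<forall>t\<in>Pow X. sat W R V w (f t))"
      using ex_Conj[of "Pow X" f X] X by auto
    have "usat W V w A \<longleftrightarrow> type_of X V ` W = S" if "w \<in> W" for W :: "'w set" and V w
    proof -
      have "usat W V w A \<longleftrightarrow> (\<forall>t\<in>Pow X. t \<in> S \<longleftrightarrow> t \<in> type_of X V ` W)"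
        unfolding A(2) by (intro ball_cong refl) (use that in \<open>auto simp: f_def \<tau>(2)\<close>)
      also have "\<dots> \<longleftrightarrow> type_of X V ` W = S"
        using S sub[of V] by blast
      finally show ?thesis .
    qed
    with A(1) show ?thesis by blast
  qed
  then obtain \<delta> where \<delta>: "\<delta> S \<in> Fm X" "w \<in> W \<Longrightarrow> usat W V w (\<delta> S) \<longleftrightarrow> type_of X V ` W = S"
    if "S \<subseteq> Pow X" for S and W :: "'w set" and V w
    by metis
  define Y where "Y = {(S, s). S \<subseteq> Pow X \<and> s \<subseteq> X \<and> Q S s}"
  define g where "g = (\<lambda>(S, s). And (\<delta> S) (\<tau> s))"
  have "finite Y"
    by (rule finite_subset[of _ "Pow (Pow X) \<times> Pow X"]) (auto simp: Y_def X)
  moreover have "g y \<in> Fm X" if "y \<in> Y" for y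
  proof -
    from that obtain S s where "y = (S, s)" "S \<subseteq> Pow X" "s \<subseteq> X" by (auto simp: Y_def)
    then show ?thesis using \<delta>(1)[of S] \<tau>(1)[of s] by (auto simp: g_def Fm_def)
  qed
  ultimately obtain A where A: "A \<in> Fm X"
    "\<And>(W :: 'w set) R V w. sat W R V w A \<longleftrightarrow> (\<exists>y\<in>Y. sat W R V w (g y))"
    using ex_Disj[of Y g X] by auto
  have "usat W V w A \<longleftrightarrow> Q (type_of X V ` W) (type_of X V w)" if w: "w \<in> W" for W :: "'w set" and V w
  proof -
    have "usat W V w A \<longleftrightarrow>
      (\<exists>(S, s)\<in>Y. type_of X V ` W = S \<and> type_of X V w = s)"
      unfolding A(2) by (intro bex_cong refl) (auto simp: Y_def g_def \<delta>(2)[OF _ w] \<tau>(2))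
    also have "\<dots> \<longleftrightarrow> Q (type_of X V ` W) (type_of X V w)"
      using sub[of V] by (auto simp: Y_def)
    finally show ?thesis .
  qed
  with A(1) show ?thesis by blast
qed

section \<open>Normality and additivity as conditions on extensions of p\<close>

lemma normal_inD:
  assumes "normal_in S5 p A" "w \<in> W"
  shows "\<not> usat W (V(p := {})) w A"
proof -
  have "usat W V w (Iff (subst1 p Bot A) Bot)"
    using assms(1) unfolding normal_in_def by (rule S5_usat) fact
  then show ?thesis by (simp add: sat_Iff sat_subst1)
qed

lemma additive_inD:
  assumes "additive_in S5 p q A" "p \<noteq> q" "q \<notin> vars A" "w \<in> W"
  shows "usat W (V(p := P \<union> Q)) w A \<longleftrightarrow> usat W (V(p := P)) w A \<or> usat W (V(p := Q)) w A"
proof -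
  \<comment> \<open>Here \<open>Or (Var p) (Var q)\<close> denotes \<open>P \<union> Q\<close>,
    while \<open>A\<close> cannot see the value of \<open>q\<close>.\<close>
  define V' where "V' = V(p := P, q := Q)"
  have upd: "usat W (V'(p := T)) w A \<longleftrightarrow> usat W (V(p := T)) w A" for T
    by (rule sat_cong) (use assms(3) in \<open>auto simp: V'_def\<close>)
  have "usat W V' w (Iff (subst1 p (Or (Var p) (Var q)) A) (Or A (subst1 p (Var q) A)))"
    using assms(1) unfolding additive_in_def by (rule S5_usat) fact
  moreover have "{u. u \<in> V' p \<or> u \<in> V' q} = V' p \<union> V' q" by auto
  ultimately have "usat W (V'(p := V' p \<union> V' q)) w A \<longleftrightarrow>
      usat W (V'(p := V' p)) w A \<or> usat W (V'(p := V' q)) w A"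
    by (simp add: sat_Iff sat_subst1)
  moreover have "V' p = P" "V' q = Q"
    using assms(2) by (auto simp: V'_def)
  ultimately show ?thesis by (simp only: upd)
qed

section \<open>The models with three copies of each type\<close>

locale normal_additive =
  fixes p q :: 'v and X :: "'v set" and \<phi> :: "'v fm"
  assumes pq: "p \<noteq> q" and pX: "p \<notin> X" and qX: "q \<notin> X" and X: "finite X"
    and vars: "vars \<phi> \<subseteq> insert p X"
    and normal: "normal_in S5 p \<phi>" and additive: "additive_in S5 p q \<phi>"
begin

text \<open>The world \<open>(t, i)\<close> is the copy of type \<open>t\<close> with index
  \<open>i\<close>. Three copies allow two distinct points inside the extension of \<open>p\<close>
  with a third of the same type left outside.\<close>

definition copies :: "'v set set \<Rightarrow> ('v set \<times> nat) set" where
  "copies S = S \<times> {..<3}"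

text \<open>A world is its own description: its first component lists the parameters true there, and
  only the extension \<open>P\<close> of \<open>p\<close> remains free.\<close>

definition F :: "'v set set \<Rightarrow> ('v set \<times> nat) set \<Rightarrow> 'v set \<times> nat \<Rightarrow> bool" where
  "F S P w = usat (copies S) ((\<lambda>x. {u. x \<in> fst u})(p := P)) w \<phi>"

definition L :: "'v set set \<Rightarrow> 'v set \<Rightarrow> bool" where
  "L S s = F S {(s, 0)} (s, 0)"

text \<open>The indices 0 and 1 keep the point in the extension apart from the point of evaluation
  even when \<open>s = t\<close>.\<close>

definition M :: "'v set set \<Rightarrow> 'v set \<Rightarrow> 'v set \<Rightarrow> bool" where
  "M S s t = F S {(t, 1)} (s, 0)"

text \<open>Normality settles the empty extension and additivity adds one point at a time, which
  reaches finite extensions only.\<close>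

lemma F_singletons:
  assumes "finite P" "w \<in> copies S"
  shows "F S P w \<longleftrightarrow> (\<exists>u\<in>P. F S {u} w)"
  using assms(1)
proof induction
  case empty
  then show ?case using normal_inD[OF normal assms(2)] by (simp add: F_def)
next
  case (insert u P)
  have "q \<notin> vars \<phi>" using vars pq qX by auto
  then have "F S ({u} \<union> P) w \<longleftrightarrow> F S {u} w \<or> F S P w"
    unfolding F_def by (rule additive_inD[OF additive pq _ assms(2)])
  then show ?case using insert by simp
qed

text \<open>The bisimulation relates points of equal type and equal membership in the extension. The
  last two hypotheses provide, for each point, a copy of its type on the matching side.\<close>

lemma F_bisim:
  assumes "fst w = fst w'" "w \<in> P \<longleftrightarrow> w' \<in> P'" "w \<in> copies S" "w' \<in> copies S"
    and "\<And>u. u \<in> copies S \<Longrightarrow> \<exists>i<3. u \<in> P \<longleftrightarrow> (fst u, i) \<in> P'"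
    and "\<And>u. u \<in> copies S \<Longrightarrow> \<exists>i<3. u \<in> P' \<longleftrightarrow> (fst u, i) \<in> P"
  shows "F S P w \<longleftrightarrow> F S P' w'"
  unfolding F_def
proof (rule usat_bisim[where Z = "\<lambda>u v. fst u = fst v \<and> (u \<in> P \<longleftrightarrow> v \<in> P')"])
  fix u assume u: "u \<in> copies S"
  from assms(5)[OF u] obtain i where "i < 3" "u \<in> P \<longleftrightarrow> (fst u, i) \<in> P'" by blast
  with u show "\<exists>v\<in>copies S. fst u = fst v \<and> (u \<in> P \<longleftrightarrow> v \<in> P')"
    by (intro bexI[of _ "(fst u, i)"]) (auto simp: copies_def)
next
  fix u assume u: "u \<in> copies S"
  from assms(6)[OF u] obtain i where "i < 3" "u \<in> P' \<longleftrightarrow> (fst u, i) \<in> P" by blast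
  with u show "\<exists>v\<in>copies S. fst v = fst u \<and> (v \<in> P \<longleftrightarrow> u \<in> P')"
    by (intro bexI[of _ "(fst u, i)"]) (auto simp: copies_def)
qed (use assms in auto)

lemma ex_less_3: "(\<exists>i<3. R i) \<longleftrightarrow> R 0 \<or> R 1 \<or> R (2::nat)"
  by (auto simp: numeral_3_eq_3 less_Suc_eq numeral_2_eq_2)

lemma F_L: "w \<in> copies S \<Longrightarrow> F S {w} w \<longleftrightarrow> L S (fst w)"
  unfolding L_def
  by (rule F_bisim) (auto simp: ex_less_3 copies_def)

text \<open>If \<open>u\<close> and \<open>w\<close> share a type, then \<open>w\<close> is one of
  its copies outside \<open>{u}\<close>, just as \<open>(s, 0)\<close> is outside
  \<open>{(t, 1)}\<close>. So which copies were chosen is invisible.\<close>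

lemma F_M:
  "w \<in> copies S \<Longrightarrow> u \<in> copies S \<Longrightarrow> u \<noteq> w \<Longrightarrow> F S {u} w \<longleftrightarrow> M S (fst w) (fst u)"
  unfolding M_def
  by (rule F_bisim) (auto simp: ex_less_3 copies_def)

text \<open>With a third copy left outside, the extensions \<open>{(s, 0), (s, 1)}\<close> and \<open>{(s, 0)}\<close> are bisimilar.\<close>

lemma M_imp_L:
  assumes "M S s s" "s \<in> S"
  shows "L S s"
proof -
  have w: "(s, 0) \<in> copies S" using assms(2) by (simp add: copies_def)
  have "F S {(s, 0), (s, 1)} (s, 0)"
    using assms(1) F_singletons[OF _ w, of "{(s, 0), (s, 1)}"] by (simp add: M_def)
  moreover have "F S {(s, 0), (s, 1)} (s, 0) \<longleftrightarrow> F S {(s, 0)} (s, 0)"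
    by (rule F_bisim) (use w in \<open>auto simp: ex_less_3\<close>)
  ultimately show ?thesis by (simp add: L_def)
qed

text \<open>The given model is bisimilar to the one on \<open>copies S\<close> with a suitable
  finite extension \<open>P\<close>. There \<open>F_singletons\<close> reduces to one point
  \<open>u'\<close>, and \<open>L\<close> or \<open>M\<close> applies according to whether
  \<open>u'\<close> is the point of evaluation.\<close>

lemma usat_iff_L_M:
  fixes V :: "'v \<Rightarrow> 'w set"
  assumes w: "w \<in> W"
  defines "ty \<equiv> type_of X V"
  shows "usat W V w \<phi> \<longleftrightarrow>
    w \<in> V p \<and> L (ty ` W) (ty w) \<or> (\<exists>u\<in>W. u \<in> V p \<and> M (ty ` W) (ty w) (ty u))"
proof -
  define S where "S = ty ` W"
  \<comment> \<open>A type realised only inside \<open>V p\<close> puts all its copies into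
    \<open>P\<close>, one realised on both sides only copy 0, and one realised only outside
    none.\<close>
  define P where "P = {(t, i) \<in> copies S.
    t \<in> ty ` (W \<inter> V p) \<and> (i = 0 \<or> t \<notin> ty ` (W - V p))}"
  \<comment> \<open>Copy 0 lies in \<open>P\<close> if the type is realised inside
    \<open>V p\<close>; copy 2 lies outside \<open>P\<close> if it is realised outside.\<close>
  define w' where "w' = (ty w, if w \<in> V p then 0 else 2 :: nat)"
  have w': "w' \<in> copies S" using w by (auto simp: w'_def copies_def S_def)
  have w'P: "w' \<in> P \<longleftrightarrow> w \<in> V p" using w by (auto simp: w'_def copies_def P_def S_def)
  have "S \<subseteq> Pow X" by (auto simp: S_def ty_def type_of_def)
  then have "finite S" using X finite_subset by blast
  then have "finite P"
    by (intro finite_subset[of P "copies S"]) (auto simp: P_def copies_def)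
  have "usat W V w \<phi> \<longleftrightarrow> F S P w'"
    unfolding F_def
  proof (rule usat_bisim[where Z = "\<lambda>u v. fst v = ty u \<and> (u \<in> V p \<longleftrightarrow> v \<in> P)"])
    fix u v x assume "fst v = ty u \<and> (u \<in> V p \<longleftrightarrow> v \<in> P)" "x \<in> vars \<phi>"
    then show "u \<in> V x \<longleftrightarrow> v \<in> ((\<lambda>x. {u. x \<in> fst u})(p := P)) x"
      using vars pX by (auto simp: ty_def type_of_def)
  next
    fix u assume "u \<in> W"
    then show "\<exists>v\<in>copies S. fst v = ty u \<and> (u \<in> V p \<longleftrightarrow> v \<in> P)"
      by (intro bexI[of _ "(ty u, if u \<in> V p then 0 else 2)"])
        (auto simp: copies_def P_def S_def)
  next
    fix v assume "v \<in> copies S"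
    then show "\<exists>u\<in>W. fst v = ty u \<and> (u \<in> V p \<longleftrightarrow> v \<in> P)"
      by (cases v) (auto simp: copies_def P_def S_def)
  qed (use w w' w'P in \<open>auto simp: w'_def\<close>)
  also have "\<dots> \<longleftrightarrow> (\<exists>u'\<in>P. F S {u'} w')"
    by (rule F_singletons) fact+
  also have "\<dots> \<longleftrightarrow> w \<in> V p \<and> L S (ty w) \<or> (\<exists>u\<in>W. u \<in> V p \<and> M S (ty w) (ty u))"
  proof
    assume "\<exists>u'\<in>P. F S {u'} w'"
    then obtain u' where u': "u' \<in> P" "F S {u'} w'" by blast
    then have "u' \<in> copies S" "\<exists>u\<in>W. u \<in> V p \<and> fst u' = ty u" by (auto simp: P_def)
    then show "w \<in> V p \<and> L S (ty w) \<or> (\<exists>u\<in>W. u \<in> V p \<and> M S (ty w) (ty u))"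
      using u' w'P F_L[OF w'] F_M[OF w', of u'] by (cases "u' = w'") (auto simp: w'_def)
  next
    assume "w \<in> V p \<and> L S (ty w) \<or> (\<exists>u\<in>W. u \<in> V p \<and> M S (ty w) (ty u))"
    then show "\<exists>u'\<in>P. F S {u'} w'"
    proof (elim disjE conjE bexE)
      assume "w \<in> V p" "L S (ty w)"
      then show ?thesis using w'P F_L[OF w'] by (auto simp: w'_def)
    next
      fix u assume u: "u \<in> W" "u \<in> V p" "M S (ty w) (ty u)"
      then have uP: "(ty u, 0) \<in> P" "(ty u, 0) \<in> copies S"
        by (auto simp: P_def copies_def S_def)
      have "F S {(ty u, 0)} w'"
      \<comment> \<open>The world \<open>u\<close> may be \<open>w\<close> itself, or another world
        represented by the same copy. Then the singleton falls under \<open>L\<close>, not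
        \<open>M\<close>, and \<open>M_imp_L\<close> bridges the two.\<close>
      proof (cases "(ty u, 0) = w'")
        case True
        then have "ty u = ty w" by (auto simp: w'_def)
        then have "L S (ty w)" using u M_imp_L[of S "ty w"] w by (auto simp: S_def)
        then show ?thesis using True F_L[OF w'] by (auto simp: w'_def)
      next
        case False
        then show ?thesis using u(3) F_M[OF w' uP(2)] by (simp add: w'_def)
      qed
      with uP show ?thesis by blast
    qed
  qed
  finally show ?thesis by (simp add: S_def)
qed

end

section \<open>The normal form and the two directions\<close>

abbreviation additive_form ::
    "'v \<Rightarrow> nat \<Rightarrow> 'v fm \<Rightarrow> (nat \<Rightarrow> 'v fm) \<Rightarrow> (nat \<Rightarrow> 'v fm) \<Rightarrow> 'v fm" where
  "additive_form p k lam mu nu \<equiv>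
    Or (Or (And lam (Var p)) (Disj (map (\<lambda>i. And (mu i) (Dia (And (nu i) (Var p)))) [0..<k]))) Bot"

lemma usat_additive_form:
  "w \<in> W \<Longrightarrow> usat W V w (additive_form p k lam mu nu) \<longleftrightarrow>
    usat W V w lam \<and> w \<in> V p \<or>
    (\<exists>i<k. usat W V w (mu i) \<and> (\<exists>u\<in>W. usat W V u (nu i) \<and> u \<in> V p))"
  by (auto simp: sat_Disj)

text \<open>Since \<open>p\<close> does not occur in the coefficients, changing the extension
  \<open>P\<close> of \<open>p\<close> affects only the two membership conditions in
  \<open>sem\<close>, which fail for the empty set and distribute over unions.\<close>

lemma normal_additive_if_form:
  assumes "equivalent_in S5 \<phi> (additive_form p k lam mu nu)" and "p \<noteq> q"
    and "p \<notin> vars lam" and "\<And>i. i < k \<Longrightarrow> p \<notin> vars (mu i) \<and> p \<notin> vars (nu i)"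
  shows "normal_additive_in S5 p q \<phi>"
proof -
  have sem: "usat W (V(p := P)) w \<phi> \<longleftrightarrow> usat W V w lam \<and> w \<in> P \<or>
      (\<exists>i<k. usat W V w (mu i) \<and> (\<exists>u\<in>W. usat W V u (nu i) \<and> u \<in> P))"
    if w: "w \<in> W" for W :: "nat set" and V P w
  proof -
    have "usat W (V(p := P)) w \<phi> \<longleftrightarrow> usat W (V(p := P)) w (additive_form p k lam mu nu)"
      using S5_usat[OF assms(1)[unfolded equivalent_in_def] w] by (simp only: sat_Iff)
    then show ?thesis
      unfolding usat_additive_form[OF w] using assms(3,4) by (simp add: sat_upd cong: conj_cong)
  qed
  have "normal_in S5 p \<phi>"
    unfolding normal_in_def by (rule S5_I) (simp add: sat_Iff sat_subst1 sem)
  moreover have "additive_in S5 p q \<phi>"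
    unfolding additive_in_def
  proof (rule S5_I)
    fix W :: "nat set" and V w
    assume w: "w \<in> W"
    \<comment> \<open>The unsubstituted \<open>\<phi>\<close> is evaluated at \<open>V\<close>
      itself, which is \<open>V\<close> with \<open>p\<close> updated to its own value.\<close>
    note sem_V = sem[OF w, of V "V p", unfolded fun_upd_triv]
    show "usat W V w (Iff (subst1 p (Or (Var p) (Var q)) \<phi>) (Or \<phi> (subst1 p (Var q) \<phi>)))"
      by (simp only: sat_Iff sat_subst1 sat.simps sem[OF w] sem_V mem_Collect_eq) blast
  qed
  ultimately show ?thesis by (simp add: normal_additive_in_def)
qed

text \<open>There is one diamond disjunct for each entry \<open>t\<close> of a list of all types:
  \<open>nu\<close> says that the type is \<open>t\<close>, and \<open>mu\<close> expresses
  \<open>M\<close> with third argument \<open>t\<close>. The formula \<open>lam\<close> expresses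
  \<open>L\<close>.\<close>

lemma (in normal_additive) ex_form:
  "\<exists>k lam mu nu. lam \<in> Fm X \<and> (\<forall>i<k. mu i \<in> Fm X \<and> nu i \<in> Fm X) \<and>
     equivalent_in S5 \<phi> (additive_form p k lam mu nu)"
proof -
  obtain ts where ts: "set ts = Pow X" using X finite_list[of "Pow X"] by auto
  obtain lam where lam: "lam \<in> Fm X" "w \<in> W \<Longrightarrow>
      usat W V w lam \<longleftrightarrow> L (type_of X V ` W) (type_of X V w)" for W :: "nat set" and V w
    using types_definable[OF X, where Q = L] by metis
  \<comment> \<open>The type \<open>t\<close> of the witness is held fixed, because the formula at
    \<open>w\<close> can refer only to the realised types and the type of \<open>w\<close>.\<close>
  have "\<exists>A\<in>Fm X. \<forall>(W :: nat set) V w. w \<in> W \<longrightarrow>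
      (usat W V w A \<longleftrightarrow> M (type_of X V ` W) (type_of X V w) t)" for t
    using types_definable[OF X, where Q = "\<lambda>S s. M S s t"] .
  then obtain m where m: "m t \<in> Fm X" "w \<in> W \<Longrightarrow>
      usat W V w (m t) \<longleftrightarrow> M (type_of X V ` W) (type_of X V w) t" for t and W :: "nat set" and V w
    by metis
  have "\<exists>A\<in>Fm X. \<forall>(W :: nat set) R V w. sat W R V w A \<longleftrightarrow> type_of X V w = t" if "t \<subseteq> X" for t
    using type_definable[OF X that] .
  then obtain n where n: "n t \<in> Fm X" "sat W R V w (n t) \<longleftrightarrow> type_of X V w = t"
    if "t \<subseteq> X" for t and W :: "nat set" and R V w
    by metis
  define k where "k = length ts"
  define mu where "mu i = m (ts ! i)" for i
  define nu where "nu i = n (ts ! i)" for i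
  have sub: "ts ! i \<subseteq> X" if "i < k" for i
    using that ts nth_mem[of i ts] by (auto simp: k_def)
  have "usat W V w \<phi> \<longleftrightarrow> usat W V w (additive_form p k lam mu nu)"
    if w: "w \<in> W" for W :: "nat set" and V w
  proof -
    let ?ty = "type_of X V"
    \<comment> \<open>Witnesses are sorted by their type, which turns the dependence of
      \<open>M\<close> on \<open>u\<close> into a finite disjunction.\<close>
    have "(\<exists>u\<in>W. u \<in> V p \<and> M (?ty ` W) (?ty w) (?ty u)) \<longleftrightarrow>
        (\<exists>i<k. M (?ty ` W) (?ty w) (ts ! i) \<and> (\<exists>u\<in>W. ?ty u = ts ! i \<and> u \<in> V p))"
    proof -
      have "\<exists>i<k. ts ! i = ?ty u" for u
      proof -
        have "?ty u \<in> set ts" unfolding ts by (auto simp: type_of_def)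
        then show ?thesis by (auto simp: in_set_conv_nth k_def)
      qed
      then show ?thesis by metis
    qed
    then show ?thesis
      unfolding usat_additive_form[OF w] usat_iff_L_M[OF w] lam(2)[OF w]
      using sub by (auto simp: mu_def nu_def m(2)[OF w] n(2) cong: conj_cong)
  qed
  then have "equivalent_in S5 \<phi> (additive_form p k lam mu nu)"
    unfolding equivalent_in_def by (intro S5_I) (simp only: sat_Iff)
  moreover have "mu i \<in> Fm X \<and> nu i \<in> Fm X" if "i < k" for i
    using m(1) n(1) sub[OF that] by (simp add: mu_def nu_def)
  ultimately show ?thesis using lam(1) by blast
qed

theorem corollary4p5:
  fixes p q :: 'v and r :: "'v list" and \<phi> :: "'v fm"
  assumes "p \<noteq> q" and "p \<notin> set r" and "q \<notin> set r"
    and "\<phi> \<in> Fm (insert p (set r))"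
  shows "normal_additive_in S5 p q \<phi> \<longleftrightarrow>
    (\<exists>(k :: nat) lam mu nu.
       lam \<in> Fm (set r) \<and> (\<forall>i<k. mu i \<in> Fm (set r) \<and> nu i \<in> Fm (set r)) \<and>
       equivalent_in S5 \<phi>
         (Or (Or (And lam (Var p))
                 (Disj (map (\<lambda>i. And (mu i) (Dia (And (nu i) (Var p)))) [0..<k])))
             Bot))"
    (is "?N \<longleftrightarrow> ?E")
proof
  assume ?N
  then interpret normal_additive p q "set r" \<phi>
    using assms by unfold_locales (auto simp: normal_additive_in_def Fm_def)
  show ?E by (rule ex_form)
next
  assume ?E
  then obtain k lam mu nu where E: "lam \<in> Fm (set r)"
    "\<forall>i<k. mu i \<in> Fm (set r) \<and> nu i \<in> Fm (set r)"
    "equivalent_in S5 \<phi> (additive_form p k lam mu nu)"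
    by (elim exE conjE)
  show ?N
    by (rule normal_additive_if_form[OF E(3) assms(1)])
      (use E(1,2) assms(2) in \<open>auto simp: Fm_def\<close>)
qed

end
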